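(* Let $G$ be an abelian group and $A\subseteq G$ a union of $k$ unbounded linear sets ($k\in\mathbb N$). Then for every $r\in\mathbb N$, $A$ is an asymptotic $\left(r,\binom{(r+1)(k-1)}{k-1}\right)$-approximate group.
   Context: $\mathbb N=\{1,2,\dots\}$, $\mathbb N_0=\{0,1,2,\dots\}$. An unbounded linear set is a set $P(a;b_1,\dots,b_d)=\{a+n_1b_1+\cdots+n_db_d:n_1,\dots,n_d\in\mathbb N_0\}$ with $a,b_j\in G$. For subsets $X,Y$, $X+Y=\{x+y:x\in X,y\in Y\}$; for $h\in\mathbb N$, $hA$ is the $h$-fold sumset and $0A=\{0\}$. A nonempty $A\subseteq G$ is an asymptotic $(r,\ell)$-approximate group if there is $h_0\in\mathbb N$ such that for every integer $h\ge h_0$ there is $X_h\subseteq G$ with $|X_h|\le\ell$ and $r(hA)\subseteq X_h+hA$. *)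

theory Defs
  imports Main "HOL-Library.Set_Algebras"
begin

text \<open>
  The sum of \<open>n\<close> copies of \<open>x\<close>. It is used both for elements of an additive monoid and,
  through the \<open>comm_monoid_add\<close> instance for sets (with \<open>X + Y = {x + y | x \<in> X, y \<in> Y}\<close> and
  neutral element \<open>{0}\<close>), for iterated sumsets: \<open>n_fold h A\<close> is the set of all sums of \<open>h\<close>
  possibly different elements of \<open>A\<close>, not the dilate \<open>{h a | a \<in> A}\<close>.
\<close>
definition n_fold :: "nat \<Rightarrow> 'a::comm_monoid_add \<Rightarrow> 'a" where
  "n_fold n x = (\<Sum>i<n. x)"

definition linear_set :: "'a::ab_group_add \<Rightarrow> 'a list \<Rightarrow> 'a set" where
  "linear_set a bs = {a + (\<Sum>j<length bs. n_fold (n j) (bs ! j)) | n :: nat \<Rightarrow> nat. True}"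

text \<open>
  An empty list of periods is allowed; this adds no new sets, because
  \<open>linear_set a [] = linear_set a [0]\<close>.
\<close>
definition is_unbounded_linear_set :: "'a::ab_group_add set \<Rightarrow> bool" where
  "is_unbounded_linear_set P \<longleftrightarrow> (\<exists>a bs. P = linear_set a bs)"

definition asymptotic_approximate_group ::
    "nat \<Rightarrow> nat \<Rightarrow> 'a::ab_group_add set \<Rightarrow> bool" where
  "asymptotic_approximate_group r l A \<longleftrightarrow>
     A \<noteq> {} \<and>
     (\<exists>h0\<ge>1. \<forall>h\<ge>h0. \<exists>X. finite X \<and> card X \<le> l \<and> n_fold r (n_fold h A) \<subseteq> X + n_fold h A)"

end

theory Submission
  imports Defs
begin

text \<open>
  Write the linear sets as \<open>a i + M i\<close> with submonoids \<open>M i\<close>. Then \<open>N A\<close> is the union, over all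
  \<open>m\<close> with \<open>\<Sum>i. m i = N\<close>, of the sets \<open>\<Sum>i. m i a i\<close> plus the sum of the \<open>M i\<close> with \<open>m i > 0\<close>.
  Hence it is enough to find few integer vectors \<open>v\<close> such that every \<open>m\<close> of total \<open>r h\<close> is
  \<open>v + c\<close> with \<open>c\<close> of total \<open>h\<close>, nonnegative, and positive wherever \<open>m\<close> is.
  For a suitable step \<open>w\<close>, the vectors \<open>v = w t - d\<close> with \<open>t\<close> of total \<open>r (k - 1)\<close> and a fixed
  correction \<open>d\<close> of the total suffice. For \<open>k > 1\<close>, the step has to satisfy
  \<open>(r - 1) h / (r (k - 1)) \<le> w < r h / ((r + 1) (k - 1))\<close>, and such a \<open>w\<close> exists for large \<open>h\<close>
  because \<open>(r - 1) (r + 1) < r\<^sup>2\<close>.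
\<close>

section \<open>Iterated sums\<close>

lemma n_fold_0 [simp]: "n_fold 0 x = 0"
  by (simp add: n_fold_def)

lemma n_fold_Suc: "n_fold (Suc n) x = x + n_fold n x"
  by (simp add: n_fold_def add.commute)

lemma n_fold_add: "n_fold (m + n) x = n_fold m x + n_fold n x"
  by (induction m) (simp_all add: n_fold_Suc add.assoc)

lemma n_fold_mult: "n_fold m (n_fold n x) = n_fold (m * n) x"
  by (induction m) (simp_all add: n_fold_Suc n_fold_add)

section \<open>Linear sets as translates of submonoids, and their sumsets\<close>

lemma linear_set_eq_translate:
  fixes a :: "'a::ab_group_add"
  shows "linear_set a bs = (+) a ` linear_set 0 bs"
  by (auto simp: linear_set_def)

lemma zero_in_linear_set_0: "0 \<in> linear_set (0::'a::ab_group_add) bs"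
  unfolding linear_set_def by (auto intro!: exI[of _ "\<lambda>_. 0"])

lemma linear_set_0_add_closed:
  fixes x y :: "'a::ab_group_add"
  assumes "x \<in> linear_set 0 bs" "y \<in> linear_set 0 bs"
  shows "x + y \<in> linear_set 0 bs"
proof -
  obtain m n where "x = (\<Sum>j<length bs. n_fold (m j) (bs ! j))"
    "y = (\<Sum>j<length bs. n_fold (n j) (bs ! j))"
    using assms by (auto simp: linear_set_def)
  then have "x + y = 0 + (\<Sum>j<length bs. n_fold (m j + n j) (bs ! j))"
    by (simp add: n_fold_add sum.distrib)
  then show ?thesis
    unfolding linear_set_def by (intro CollectI exI[of _ "\<lambda>j. m j + n j"]) simp
qed

lemma sum_update:
  fixes f :: "'i \<Rightarrow> 'b::comm_monoid_add"
  assumes "finite I" "j \<in> I" "g j = x + f j" "\<And>i. i \<in> I \<Longrightarrow> i \<noteq> j \<Longrightarrow> g i = f i"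
  shows "sum g I = x + sum f I"
proof -
  have "sum g (I - {j}) = sum f (I - {j})"
    using assms(4) by (intro sum.cong) auto
  then show ?thesis
    using assms(1-3) by (simp add: sum.remove[of I j] add.assoc)
qed

text \<open>Here \<open>m i\<close> counts the summands taken from the \<open>i\<close>-th
  translate, and \<open>z i\<close> collects their parts in \<open>M i\<close>. Closure under
  addition merges these parts into one element of \<open>M i\<close>; conversely one summand can
  carry all of \<open>z i\<close> while the others carry 0.\<close>

lemma mem_n_fold_Union_translates:
  fixes a :: "'i \<Rightarrow> 'a::ab_group_add" and M :: "'i \<Rightarrow> 'a set"
  assumes fin: "finite I"
    and zero: "\<And>i. i \<in> I \<Longrightarrow> 0 \<in> M i"
    and add: "\<And>i x y. i \<in> I \<Longrightarrow> x \<in> M i \<Longrightarrow> y \<in> M i \<Longrightarrow> x + y \<in> M i"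
  shows "y \<in> n_fold N (\<Union>i\<in>I. (+) (a i) ` M i) \<longleftrightarrow>
    (\<exists>m z. sum m I = N \<and> (\<forall>i\<in>I. z i \<in> M i \<and> (m i = 0 \<longrightarrow> z i = 0)) \<and>
      y = (\<Sum>i\<in>I. n_fold (m i) (a i) + z i))"
proof (induction N arbitrary: y)
  case 0
  show ?case
  proof
    assume "y \<in> n_fold 0 (\<Union>i\<in>I. (+) (a i) ` M i)"
    then show "\<exists>m z. sum m I = 0 \<and> (\<forall>i\<in>I. z i \<in> M i \<and> (m i = 0 \<longrightarrow> z i = 0)) \<and>
        y = (\<Sum>i\<in>I. n_fold (m i) (a i) + z i)"
      using zero by (intro exI[of _ "\<lambda>_. 0"]) simp
  qed (use fin in auto)
next
  case (Suc N)
  let ?A = "\<Union>i\<in>I. (+) (a i) ` M i"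
  show ?case
  proof
    assume "y \<in> n_fold (Suc N) ?A"
    then obtain j q y' where j: "j \<in> I" and q: "q \<in> M j" and y': "y' \<in> n_fold N ?A"
      and y: "y = (a j + q) + y'"
      by (auto simp: n_fold_Suc elim!: set_plus_elim)
    obtain m z where m: "sum m I = N"
      and z: "\<And>i. i \<in> I \<Longrightarrow> z i \<in> M i" "\<And>i. i \<in> I \<Longrightarrow> m i = 0 \<Longrightarrow> z i = 0"
      and y'_eq: "y' = (\<Sum>i\<in>I. n_fold (m i) (a i) + z i)"
      using y' Suc.IH by blast
    let ?m = "m(j := Suc (m j))" and ?z = "z(j := q + z j)"
    have "sum ?m I = 1 + sum m I"
      using fin j by (intro sum_update[where j = j]) auto
    moreover have "(\<Sum>i\<in>I. n_fold (?m i) (a i) + ?z i) = (a j + q) + y'"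
      unfolding y'_eq using fin j
      by (intro sum_update[where j = j]) (auto simp: n_fold_Suc algebra_simps)
    ultimately show "\<exists>m z. sum m I = Suc N \<and> (\<forall>i\<in>I. z i \<in> M i \<and> (m i = 0 \<longrightarrow> z i = 0)) \<and>
        y = (\<Sum>i\<in>I. n_fold (m i) (a i) + z i)"
      using y m z j q add by (intro exI[of _ ?m] exI[of _ ?z]) auto
  next
    assume "\<exists>m z. sum m I = Suc N \<and> (\<forall>i\<in>I. z i \<in> M i \<and> (m i = 0 \<longrightarrow> z i = 0)) \<and>
        y = (\<Sum>i\<in>I. n_fold (m i) (a i) + z i)"
    then obtain m z where m: "sum m I = Suc N"
      and z: "\<And>i. i \<in> I \<Longrightarrow> z i \<in> M i" "\<And>i. i \<in> I \<Longrightarrow> m i = 0 \<Longrightarrow> z i = 0"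
      and y: "y = (\<Sum>i\<in>I. n_fold (m i) (a i) + z i)"
      by blast
    obtain j where j: "j \<in> I" "m j \<noteq> 0"
      using m by (metis sum.neutral nat.distinct(1))
    then obtain n where n: "m j = Suc n"
      using not0_implies_Suc by blast
    \<comment> \<open>The last summand from the \<open>j\<close>-th translate must carry all of
      \<open>z j\<close>, since nothing may remain once the count is 0. An earlier one carries
      0.\<close>
    define q where "q = (if n = 0 then z j else 0)"
    let ?m = "m(j := n)" and ?z = "z(j := z j - q)"
    let ?y = "\<Sum>i\<in>I. n_fold (?m i) (a i) + ?z i"
    have "sum m I = 1 + sum ?m I"
      using fin j n by (intro sum_update[where j = j]) auto
    then have "sum ?m I = N"
      using m by simp
    moreover have "\<forall>i\<in>I. ?z i \<in> M i \<and> (?m i = 0 \<longrightarrow> ?z i = 0)"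
      using z zero by (auto simp: q_def)
    ultimately have "?y \<in> n_fold N ?A"
      using Suc.IH by blast
    moreover have "q \<in> M j"
      using j z zero by (simp add: q_def)
    then have "a j + q \<in> ?A"
      using j by blast
    moreover have "y = (a j + q) + ?y"
      unfolding y using fin j n
      by (intro sum_update[where j = j]) (auto simp: n_fold_Suc algebra_simps)
    ultimately show "y \<in> n_fold (Suc N) ?A"
      by (auto simp only: n_fold_Suc intro: set_plus_intro)
  qed
qed

section \<open>Natural vectors of given total\<close>

text \<open>Stars and bars: an enumeration of \<open>I\<close> turns the lists of length
  \<open>card I\<close> and sum \<open>T\<close> into a family covering \<open>S\<close>.\<close>

lemma card_functions_sum_eq:
  fixes T :: nat
  assumes "finite I"
  defines "S \<equiv> {t :: 'i \<Rightarrow> nat. (\<forall>i. i \<notin> I \<longrightarrow> t i = 0) \<and> sum t I = T}"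
  shows "finite S" and "card S \<le> (T + card I - 1) choose T"
proof -
  let ?k = "card I"
  let ?Ls = "{l :: nat list. length l = ?k \<and> sum_list l = T}"
  obtain f where f: "bij_betw f I {0..<?k}"
    using ex_bij_betw_finite_nat[OF assms(1)] by blast
  let ?g = "inv_into I f"
  have g: "bij_betw ?g {0..<?k} I"
    using f by (rule bij_betw_inv_into)
  let ?\<phi> = "\<lambda>l i. if i \<in> I then l ! f i else (0::nat)"
  have sub: "S \<subseteq> ?\<phi> ` ?Ls"
  proof
    fix t assume t: "t \<in> S"
    let ?l = "map (\<lambda>n. t (?g n)) [0..<?k]"
    have "sum_list ?l = (\<Sum>n\<in>{0..<?k}. t (?g n))"
      by (simp add: interv_sum_list_conv_sum_set_nat)
    also have "\<dots> = sum t I"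
      using g by (rule sum.reindex_bij_betw)
    finally have "?l \<in> ?Ls"
      using t by (simp add: S_def)
    moreover have "t = ?\<phi> ?l"
    proof
      fix i
      show "t i = ?\<phi> ?l i"
      proof (cases "i \<in> I")
        case True
        then have "f i < ?k" "?g (f i) = i"
          using f bij_betwE bij_betw_inv_into_left by fastforce+
        then show ?thesis
          using True by simp
      qed (use t in \<open>simp add: S_def\<close>)
    qed
    ultimately show "t \<in> ?\<phi> ` ?Ls"
      by blast
  qed
  have fin: "finite ?Ls"
  proof (rule finite_subset)
    show "?Ls \<subseteq> {l. set l \<subseteq> {..T} \<and> length l = ?k}"
      by (auto dest: member_le_sum_list)
  qed (simp add: finite_lists_length_eq)
  show "finite S"
    using fin sub by (rule finite_surj)
  show "card S \<le> (T + ?k - 1) choose T"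
    using surj_card_le[OF fin sub] by (simp add: card_length_sum_list)
qed

text \<open>Greedy choice: each index takes as much of the total as its bound allows.\<close>

lemma ex_le_with_sum:
  fixes f :: "'i \<Rightarrow> nat"
  assumes "finite I" "T \<le> sum f I"
  shows "\<exists>t. (\<forall>i. t i \<le> f i) \<and> (\<forall>i. i \<notin> I \<longrightarrow> t i = 0) \<and> sum t I = T"
  using assms
proof (induction I arbitrary: T rule: finite_induct)
  case empty
  then show ?case
    by (intro exI[of _ "\<lambda>_. 0"]) auto
next
  case (insert j I)
  have "T - min T (f j) \<le> sum f I"
    using insert by simp
  then obtain t where t: "\<forall>i. t i \<le> f i" "\<forall>i. i \<notin> I \<longrightarrow> t i = 0" "sum t I = T - min T (f j)"
    using insert.IH by blast
  let ?t = "t(j := min T (f j))"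
  have "sum ?t I = sum t I"
    using insert by (intro sum.cong) auto
  then show ?case
    using insert t by (intro exI[of _ ?t]) auto
qed

section \<open>Covering vectors\<close>

text \<open>Take \<open>w\<close> to be one more than the rounded-down quotient of
  \<open>(r - 1) * h\<close> by \<open>r * p\<close>. After multiplication by \<open>r\<close>, the
  added 1 costs \<open>r * (r + 1) * p\<close> in the upper bound, which is less than the spare
  \<open>h = r * r * h - (r + 1) * (r - 1) * h\<close>.\<close>

lemma ex_step:
  fixes r p h :: nat
  assumes "r \<ge> 1" "p \<ge> 1" "h > r * (r + 1) * p"
  obtains w where "w \<ge> 1" "(r - 1) * h \<le> w * (r * p)" "w * ((r + 1) * p) < r * h"
proof -
  obtain s where s: "r = Suc s"
    using assms(1) by (cases r) auto
  define q where "q = s * h div (r * p)"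
  have q: "q * (r * p) \<le> s * h"
    unfolding q_def by simp
  have "s * h mod (r * p) < r * p"
    using assms by simp
  then have "s * h \<le> Suc q * (r * p)"
    using div_mult_mod_eq[of "s * h" "r * p"] unfolding q_def by simp
  moreover have "Suc q * ((r + 1) * p) < r * h"
  proof -
    have "r * (Suc q * ((r + 1) * p)) = (r + 1) * (q * (r * p)) + r * (r + 1) * p"
      by (simp add: algebra_simps)
    also have "\<dots> < (r + 1) * (s * h) + h"
      using mult_le_mono2[OF q, of "r + 1"] assms(3) by linarith
    also have "\<dots> = r * (r * h)"
      by (simp add: s algebra_simps)
    finally show ?thesis
      by simp
  qed
  ultimately show ?thesis
    using that[of "Suc q"] s by simp
qed

text \<open>The vectors \<open>v\<close> of the introduction are encoded as differences \<open>u - d\<close> of natural vectors.\<close>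

lemma ex_covering_vectors:
  fixes r h :: nat
  assumes fin: "finite I" and card: "card I = Suc p" and r: "r \<ge> 1"
    and h: "h > r * (r + 1) * p"
  shows "\<exists>U d. finite U \<and> card U \<le> ((r + 1) * p) choose p \<and>
    (\<forall>m. sum m I = r * h \<longrightarrow> (\<exists>u\<in>U. \<exists>c. sum c I = h \<and>
      (\<forall>i\<in>I. m i + d i = c i + u i \<and> (m i \<noteq> 0 \<longrightarrow> c i \<noteq> (0::nat)))))"
proof (cases "p = 0")
  case True
  then obtain j where I: "I = {j}"
    using card card_1_singletonE by auto
  \<comment> \<open>With a single index, \<open>m j = r * h\<close>; removing
    \<open>(r - 1) * h\<close> leaves \<open>h\<close>, which is positive.\<close>
  have "r * h = h + (r - 1) * h"
    using r by (cases r) auto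
  then show ?thesis
    using I h True
    by (intro exI[of _ "{\<lambda>_. (r - 1) * h}"] exI[of _ "\<lambda>_. 0"]) (auto intro!: exI[of _ "\<lambda>_. h"])
next
  case False
  then obtain w where w: "w \<ge> 1" and w_ge: "(r - 1) * h \<le> w * (r * p)"
    and w_less: "w * ((r + 1) * p) < r * h"
    using ex_step[of r p h] r h by auto
  obtain j where j: "j \<in> I"
    using card by fastforce
  define T where "T = r * p"
  define S where "S = {t :: 'a \<Rightarrow> nat. (\<forall>i. i \<notin> I \<longrightarrow> t i = 0) \<and> sum t I = T}"
  define U where "U = (\<lambda>t i. w * t i) ` S"
  \<comment> \<open>Each \<open>u\<close> in \<open>U\<close> has total \<open>w * T\<close>,
    whereas \<open>(r - 1) * h\<close> has to be removed. The excess, nonnegative by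
    \<open>w_ge\<close>, is given back at the one index \<open>j\<close>.\<close>
  define d where "d = (\<lambda>i. if i = j then w * T - (r - 1) * h else 0)"
  have finS: "finite S"
    unfolding S_def by (rule card_functions_sum_eq(1)[OF fin])
  have "card U \<le> card S"
    unfolding U_def using finS by (rule card_image_le)
  also have "\<dots> \<le> (T + card I - 1) choose T"
    unfolding S_def by (rule card_functions_sum_eq(2)[OF fin])
  also have "\<dots> = ((r + 1) * p) choose p"
    using binomial_symmetric[of p "(r + 1) * p"] by (simp add: card T_def add.commute)
  finally have cardU: "card U \<le> ((r + 1) * p) choose p" .
  have "\<exists>u\<in>U. \<exists>c. sum c I = h \<and>
      (\<forall>i\<in>I. m i + d i = c i + u i \<and> (m i \<noteq> 0 \<longrightarrow> c i \<noteq> 0))" if m: "sum m I = r * h" for m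
  proof -
    \<comment> \<open>The largest multiple of \<open>w\<close> that can be removed while a positive
      \<open>m i\<close> stays positive; truncated subtraction gives \<open>f i = 0\<close> when
      \<open>m i = 0\<close>.\<close>
    define f where "f i = (m i - 1) div w" for i
    have "m i \<le> w * f i + w" for i
    proof -
      have "m i - 1 = w * f i + (m i - 1) mod w"
        by (simp add: f_def)
      moreover have "(m i - 1) mod w < w"
        using w by simp
      ultimately show ?thesis
        by linarith
    qed
    then have "sum m I \<le> (\<Sum>i\<in>I. w * f i + w)"
      by (rule sum_mono)
    also have "\<dots> = w * (sum f I + Suc p)"
      by (simp add: sum.distrib sum_distrib_left card algebra_simps)
    \<comment> \<open>Rounding loses at most \<open>w\<close> at each of the \<open>p + 1\<close>
      indices. The strict bound \<open>w_less\<close> absorbs this and leaves \<open>sum f I\<close>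
      at least \<open>r * p = T\<close>.\<close>
    finally have "w * ((r + 1) * p) < w * (sum f I + Suc p)"
      using w_less m by linarith
    then have "(r + 1) * p < sum f I + Suc p"
      using mult_less_cancel1 by blast
    then have "T \<le> sum f I"
      by (simp add: T_def)
    then obtain t where t: "\<And>i. t i \<le> f i" and tS: "t \<in> S"
      using ex_le_with_sum[OF fin] unfolding S_def by blast
    have wt: "w * t i \<le> m i - 1" for i
    proof -
      have "w * t i \<le> w * f i"
        using t by simp
      also have "\<dots> \<le> m i - 1"
        by (simp add: f_def)
      finally show ?thesis .
    qed
    define c where "c i = m i + d i - w * t i" for i
    have c: "m i + d i = c i + w * t i" for i
      using wt[of i] by (simp add: c_def)
    have "sum m I + sum d I = sum c I + w * sum t I"
      by (simp add: c sum_distrib_left flip: sum.distrib)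
    then have "sum m I + sum d I = sum c I + w * T"
      using tS by (simp add: S_def)
    moreover have "sum d I = w * T - (r - 1) * h"
      using j fin by (simp add: d_def)
    moreover have "r * h = h + (r - 1) * h"
      using r by (cases r) auto
    ultimately have "sum c I = h"
      using w_ge m by (simp add: T_def)
    moreover have "c i \<noteq> 0" if "m i \<noteq> 0" for i
      using wt[of i] that by (simp add: c_def)
    ultimately show ?thesis
      using c tS by (intro bexI[of _ "\<lambda>i. w * t i"] exI[of _ c]) (auto simp: U_def)
  qed
  then show ?thesis
    using finS cardU by (intro exI[of _ U] exI[of _ d]) (simp add: U_def)
qed

section \<open>Transfer to the group\<close>

text \<open>A vector \<open>v = u - d\<close> becomes the translation by the combination of the
  \<open>a i\<close> with coefficients \<open>v i\<close>; mapping \<open>U\<close> to these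
  translations cannot increase its cardinality.\<close>

lemma asymptotic_approximate_group_Union_translates:
  fixes a :: "'i \<Rightarrow> 'a::ab_group_add" and M :: "'i \<Rightarrow> 'a set"
  assumes fin: "finite I" and card: "card I = Suc p" and r: "r \<ge> 1"
    and zero: "\<And>i. i \<in> I \<Longrightarrow> 0 \<in> M i"
    and add: "\<And>i x y. i \<in> I \<Longrightarrow> x \<in> M i \<Longrightarrow> y \<in> M i \<Longrightarrow> x + y \<in> M i"
  shows "asymptotic_approximate_group r (((r + 1) * p) choose p) (\<Union>i\<in>I. (+) (a i) ` M i)"
    (is "asymptotic_approximate_group r ?l ?A")
  unfolding asymptotic_approximate_group_def
proof (intro conjI exI[of _ "Suc (r * (r + 1) * p)"] allI impI)
  show "?A \<noteq> {}"
    using card zero by fastforce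
  show "1 \<le> Suc (r * (r + 1) * p)"
    by simp
  fix h assume "h \<ge> Suc (r * (r + 1) * p)"
  then have "h > r * (r + 1) * p"
    by simp
  from ex_covering_vectors[OF fin card r this]
  obtain U d where U: "finite U" "card U \<le> ?l" and cover: "\<And>m. sum m I = r * h \<Longrightarrow>
      \<exists>u\<in>U. \<exists>c. sum c I = h \<and> (\<forall>i\<in>I. m i + d i = c i + u i \<and> (m i \<noteq> 0 \<longrightarrow> c i \<noteq> (0::nat)))"
    by blast
  let ?comb = "\<lambda>v. \<Sum>i\<in>I. n_fold (v i) (a i)"
  let ?X = "(\<lambda>u. ?comb u - ?comb d) ` U"
  have "y \<in> ?X + n_fold h ?A" if y: "y \<in> n_fold r (n_fold h ?A)" for y
  proof -
    obtain m z where m: "sum m I = r * h"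
      and z: "\<And>i. i \<in> I \<Longrightarrow> z i \<in> M i" "\<And>i. i \<in> I \<Longrightarrow> m i = 0 \<Longrightarrow> z i = 0"
      and y_eq: "y = (\<Sum>i\<in>I. n_fold (m i) (a i) + z i)"
      using y mem_n_fold_Union_translates[where I = I and M = M, OF fin zero add]
      unfolding n_fold_mult by blast
    obtain u c where u: "u \<in> U" and c: "sum c I = h"
      and mc: "\<And>i. i \<in> I \<Longrightarrow> m i + d i = c i + u i" "\<And>i. i \<in> I \<Longrightarrow> m i \<noteq> 0 \<Longrightarrow> c i \<noteq> 0"
      using cover[OF m] by blast
    have "?comb m + ?comb d = ?comb c + ?comb u"
      using mc(1) by (simp flip: sum.distrib n_fold_add)
    then have "y = (?comb u - ?comb d) + (\<Sum>i\<in>I. n_fold (c i) (a i) + z i)"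
      unfolding y_eq sum.distrib by (simp add: algebra_simps)
    \<comment> \<open>The same \<open>z\<close> stays admissible because \<open>c\<close> is
      positive wherever \<open>m\<close> is.\<close>
    moreover have "\<forall>i\<in>I. z i \<in> M i \<and> (c i = 0 \<longrightarrow> z i = 0)"
      using z mc(2) by blast
    then have "(\<Sum>i\<in>I. n_fold (c i) (a i) + z i) \<in> n_fold h ?A"
      using c mem_n_fold_Union_translates[where I = I and M = M, OF fin zero add] by blast
    ultimately show ?thesis
      using u by blast
  qed
  then show "\<exists>X. finite X \<and> card X \<le> ?l \<and> n_fold r (n_fold h ?A) \<subseteq> X + n_fold h ?A"
    using U card_image_le[OF U(1), of "\<lambda>u. ?comb u - ?comb d"]
    by (intro exI[of _ ?X]) auto
qed

theorem theorem2p14: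
  fixes A :: "'a::ab_group_add set" and L :: "nat \<Rightarrow> 'a set" and k r :: nat
  assumes "k \<ge> 1"
    and "\<And>i. i \<in> {1..k} \<Longrightarrow> is_unbounded_linear_set (L i)"
    and "A = (\<Union>i\<in>{1..k}. L i)"
    and "r \<ge> 1"
  shows "asymptotic_approximate_group r (((r + 1) * (k - 1)) choose (k - 1)) A"
proof -
  obtain a bs where L: "\<And>i. i \<in> {1..k} \<Longrightarrow> L i = (+) (a i) ` linear_set 0 (bs i)"
    using assms(2) linear_set_eq_translate unfolding is_unbounded_linear_set_def by metis
  have "A = (\<Union>i\<in>{1..k}. (+) (a i) ` linear_set 0 (bs i))"
    unfolding assms(3) using L by (rule SUP_cong[OF refl])
  moreover have "asymptotic_approximate_group r (((r + 1) * (k - 1)) choose (k - 1)) \<dots>"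
    using assms(1,4) zero_in_linear_set_0 linear_set_0_add_closed
    by (intro asymptotic_approximate_group_Union_translates) auto
  ultimately show ?thesis
    by simp
qed

end
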